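(* Let $(\gamma,\nu_1,\nu_2):I\to\mathbb{R}^3\times\Delta$ be a framed curve with curvature $(\ell,m,n,\alpha)$. Then $(\gamma,\nu_1,\nu_2)$ is a $(\nu_1,\nu_2,\overline{\nu}_2)$-Bertrand framed curve if and only if there exist a smooth map $(\lambda,\eta):I\to\mathbb{R}^2$ with $(\lambda,\eta)\not\equiv(0,0)$ and a smooth function $\theta:I\to\mathbb{R}$ such that $$\alpha(t)+\lambda(t)m(t)+\eta(t)n(t)=0,$$ $$(\dot\lambda(t)-\eta(t)\ell(t))\sin\theta(t)+(\lambda(t)\ell(t)+\dot\eta(t))\cos\theta(t)=0$$ for all $t\in I$.
   Context: All maps are $C^\infty$; $I\subset\mathbb{R}$ is an interval. Let $\Delta=\{(a,b)\in S^2\times S^2\mid a\cdot b=0\}$. A smooth map $(\gamma,\nu_1,\nu_2):I\to\mathbb{R}^3\times\Delta$ is a framed curve if $\dot\gamma(t)\cdot\nu_1(t)=\dot\gamma(t)\cdot\nu_2(t)=0$ for all $t\in I$ ($\gamma$ may have singular points). Put $\mu=\nu_1\times\nu_2$. The curvature $(\ell,m,n,\alpha)$ of the framed curve is $\ell=\dot\nu_1\cdot\nu_2$, $m=\dot\nu_1\cdot\mu$, $n=\dot\nu_2\cdot\mu$, $\alpha=\dot\gamma\cdot\mu$; thus $\dot\gamma=\alpha\mu$. For a second framed curve $(\overline\gamma,\overline\nu_1,\overline\nu_2)$, put $\overline\mu=\overline\nu_1\times\overline\nu_2$. For $v,w,x\in\{\nu_1,\nu_2,\mu\}$, framed curves $(\gamma,\nu_1,\nu_2)$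 and $(\overline\gamma,\overline\nu_1,\overline\nu_2)$ are $(v,w,\overline x)$-mates if there exists a smooth map $(\lambda,\eta):I\to\mathbb{R}^2$ with $(\lambda,\eta)\not\equiv(0,0)$ such that $\overline\gamma(t)=\gamma(t)+\lambda(t)v(t)+\eta(t)w(t)$ and $v(t)\times w(t)=\overline x(t)$ for all $t\in I$. $(\gamma,\nu_1,\nu_2)$ is a $(v,w,\overline x)$-Bertrand framed curve if there exists a framed curve $(\overline\gamma,\overline\nu_1,\overline\nu_2)$ such that the two are $(v,w,\overline x)$-mates. Here $(\lambda,\eta)\not\equiv(0,0)$ means that $(\lambda,\eta)$ is not identically zero on any non-trivial subinterval of $I$. *)

theory Defs
  imports "HOL-Analysis.Analysis"
begin

text \<open>Intervals may be open, closed, half-open or unbounded. Having two distinct points makes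
  the derivative within the interval unique at each of its points; it is one-sided at an
  end point that belongs to the interval.\<close>

definition nontrivial_interval :: "real set \<Rightarrow> bool" where
  "nontrivial_interval I \<longleftrightarrow> is_interval I \<and> (\<exists>a\<in>I. \<exists>b\<in>I. a < b)"

definition deriv_on :: "real set \<Rightarrow> (real \<Rightarrow> 'a::real_normed_vector) \<Rightarrow> real \<Rightarrow> 'a" where
  "deriv_on I f = (\<lambda>t. vector_derivative f (at t within I))"

definition smooth_map_on :: "real set \<Rightarrow> (real \<Rightarrow> 'a::real_normed_vector) \<Rightarrow> bool" where
  "smooth_map_on I f \<longleftrightarrow> (\<forall>k::nat. ((deriv_on I ^^ k) f) differentiable_on I)"

definition Delta :: "((real^3) \<times> (real^3)) set" where
  "Delta = {(a, b). a \<in> sphere 0 1 \<and> b \<in> sphere 0 1 \<and> a \<bullet> b = 0}"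

text \<open>Maps on the interval are total functions whose values outside it are irrelevant.\<close>

definition framed_curve ::
  "real set \<Rightarrow> (real \<Rightarrow> real^3) \<Rightarrow> (real \<Rightarrow> real^3) \<Rightarrow> (real \<Rightarrow> real^3) \<Rightarrow> bool" where
  "framed_curve I \<gamma> \<nu>1 \<nu>2 \<longleftrightarrow>
     smooth_map_on I (\<lambda>t. (\<gamma> t, \<nu>1 t, \<nu>2 t)) \<and>
     (\<forall>t\<in>I. (\<nu>1 t, \<nu>2 t) \<in> Delta) \<and>
     (\<forall>t\<in>I. deriv_on I \<gamma> t \<bullet> \<nu>1 t = 0 \<and> deriv_on I \<gamma> t \<bullet> \<nu>2 t = 0)"

definition mu_of :: "(real \<Rightarrow> real^3) \<Rightarrow> (real \<Rightarrow> real^3) \<Rightarrow> real \<Rightarrow> real^3" where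
  "mu_of \<nu>1 \<nu>2 = (\<lambda>t. cross3 (\<nu>1 t) (\<nu>2 t))"

definition curvature ::
  "real set \<Rightarrow> (real \<Rightarrow> real^3) \<Rightarrow> (real \<Rightarrow> real^3) \<Rightarrow> (real \<Rightarrow> real^3) \<Rightarrow>
   real \<Rightarrow> real \<times> real \<times> real \<times> real" where
  "curvature I \<gamma> \<nu>1 \<nu>2 = (\<lambda>t.
     (deriv_on I \<nu>1 t \<bullet> \<nu>2 t,
      deriv_on I \<nu>1 t \<bullet> mu_of \<nu>1 \<nu>2 t,
      deriv_on I \<nu>2 t \<bullet> mu_of \<nu>1 \<nu>2 t,
      deriv_on I \<gamma> t \<bullet> mu_of \<nu>1 \<nu>2 t))"

text \<open>The symbols \<open>v\<close>, \<open>w\<close>, \<open>x\<close> of a \<open>(v, w, x)\<close>-mate name members of a moving frame, and the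
  third one is read in the frame of the second curve; hence they are names, not maps.\<close>

datatype frame_vector = Nu1 | Nu2 | Mu

fun frame_vec ::
  "frame_vector \<Rightarrow> (real \<Rightarrow> real^3) \<Rightarrow> (real \<Rightarrow> real^3) \<Rightarrow> real \<Rightarrow> real^3" where
  "frame_vec Nu1 \<nu>1 \<nu>2 = \<nu>1"
| "frame_vec Nu2 \<nu>1 \<nu>2 = \<nu>2"
| "frame_vec Mu \<nu>1 \<nu>2 = mu_of \<nu>1 \<nu>2"

text \<open>The condition written \<open>f \<not>\<equiv> 0\<close> in the theory of framed curves: stronger than
  \<open>f\<close> not being the zero map on \<open>I\<close>.\<close>

definition not_identically_zero :: "real set \<Rightarrow> (real \<Rightarrow> 'a::zero) \<Rightarrow> bool" where
  "not_identically_zero I f \<longleftrightarrow>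
     (\<forall>J\<subseteq>I. nontrivial_interval J \<longrightarrow> \<not> (\<forall>t\<in>J. f t = 0))"

definition mates ::
  "real set \<Rightarrow> frame_vector \<Rightarrow> frame_vector \<Rightarrow> frame_vector \<Rightarrow>
   (real \<Rightarrow> real^3) \<Rightarrow> (real \<Rightarrow> real^3) \<Rightarrow> (real \<Rightarrow> real^3) \<Rightarrow>
   (real \<Rightarrow> real^3) \<Rightarrow> (real \<Rightarrow> real^3) \<Rightarrow> (real \<Rightarrow> real^3) \<Rightarrow> bool" where
  "mates I v w x \<gamma> \<nu>1 \<nu>2 \<gamma>' \<nu>1' \<nu>2' \<longleftrightarrow>
     framed_curve I \<gamma> \<nu>1 \<nu>2 \<and> framed_curve I \<gamma>' \<nu>1' \<nu>2' \<and>
     (\<exists>lam \<eta> :: real \<Rightarrow> real.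
        smooth_map_on I (\<lambda>t. (lam t, \<eta> t)) \<and>
        not_identically_zero I (\<lambda>t. (lam t, \<eta> t)) \<and>
        (\<forall>t\<in>I. \<gamma>' t = \<gamma> t + lam t *\<^sub>R frame_vec v \<nu>1 \<nu>2 t + \<eta> t *\<^sub>R frame_vec w \<nu>1 \<nu>2 t \<and>
               cross3 (frame_vec v \<nu>1 \<nu>2 t) (frame_vec w \<nu>1 \<nu>2 t) = frame_vec x \<nu>1' \<nu>2' t))"

definition Bertrand_framed_curve ::
  "real set \<Rightarrow> frame_vector \<Rightarrow> frame_vector \<Rightarrow> frame_vector \<Rightarrow>
   (real \<Rightarrow> real^3) \<Rightarrow> (real \<Rightarrow> real^3) \<Rightarrow> (real \<Rightarrow> real^3) \<Rightarrow> bool" where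
  "Bertrand_framed_curve I v w x \<gamma> \<nu>1 \<nu>2 \<longleftrightarrow>
     (\<exists>\<gamma>' \<nu>1' \<nu>2'. framed_curve I \<gamma>' \<nu>1' \<nu>2' \<and> mates I v w x \<gamma> \<nu>1 \<nu>2 \<gamma>' \<nu>1' \<nu>2')"

end

theory Submission
  imports Defs
begin

text \<open>Write \<open>\<gamma>' = \<gamma> + \<lambda> \<nu>1 + \<eta> \<nu>2\<close> for the second curve and \<open>D\<close> for the derivative. The
  Frenet-type formulas of the frame \<open>(\<nu>1, \<nu>2, \<mu>)\<close> give
  \<open>D\<gamma>' = (D\<lambda> - \<eta> l) \<nu>1 + (\<lambda> l + D\<eta>) \<nu>2 + (\<alpha> + \<lambda> m + \<eta> n) \<mu>\<close>
  (lemma \<open>deriv_on_parallel_curve\<close>). A mate must have \<open>\<mu>\<close> as the second vector of its frame, so the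
  first equation says exactly that its velocity is orthogonal to that vector. The first vector of
  its frame is then a unit vector in the plane of \<open>\<nu>1\<close> and \<open>\<nu>2\<close>, hence of the form
  \<open>sin \<theta> \<nu>1 + cos \<theta> \<nu>2\<close>, and the second equation is the orthogonality of the velocity to it.

  Read backwards, this constructs the mate from \<open>\<lambda>\<close>, \<open>\<eta>\<close>, \<open>\<theta>\<close>. Read forwards, the one thing that
  needs an argument is that \<open>\<theta>\<close> can be chosen smooth on the whole interval. An interval is
  contractible, so the curve \<open>cos \<theta> + i sin \<theta>\<close> has a continuous logarithm, whose imaginary part is a
  continuous \<open>\<theta>\<close>. Up to a constant, \<open>\<theta>\<close> is locally the arcsine of a smooth function, so it is
  differentiable, and its derivative is a polynomial in the coordinates of the circle-valued curve
  and their derivatives, so it is smooth (lemma \<open>smooth_angle_function\<close>).\<close>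

section \<open>Smooth maps on an interval\<close>

text \<open>Derivatives within the interval are unique because none of its points is isolated.\<close>

lemma nontrivial_interval_at_within_neq_bot:
  assumes "nontrivial_interval I" "t \<in> I"
  shows "at t within I \<noteq> bot"
proof -
  obtain a b where ab: "a \<in> I" "b \<in> I" "a < b" and "is_interval I"
    using assms(1) by (auto simp: nontrivial_interval_def)
  then have "connected I" "\<And>x. I \<noteq> {x}"
    by (auto simp: is_interval_connected_1)
  then show ?thesis
    using connected_imp_perfect[of I t] assms(2) by (auto simp: trivial_limit_within)
qed

lemma deriv_on_eqI:
  assumes "nontrivial_interval I" "t \<in> I" "(f has_vector_derivative d) (at t within I)"
  shows "deriv_on I f t = d"
  unfolding deriv_on_def
  using vector_derivative_within[OF nontrivial_interval_at_within_neq_bot] assms by blast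

lemma has_vector_derivative_deriv_on:
  assumes "f differentiable_on I" "t \<in> I"
  shows "(f has_vector_derivative deriv_on I f t) (at t within I)"
  using assms unfolding deriv_on_def differentiable_on_def
  by (simp add: vector_derivative_works)

lemma differentiable_onI_vector:
  assumes "\<And>t. t \<in> I \<Longrightarrow> (f has_vector_derivative f' t) (at t within I)"
  shows "f differentiable_on I"
  using assms unfolding differentiable_on_def by (blast intro: differentiableI_vector)

lemma differentiable_on_transform:
  assumes "f differentiable_on S" "\<And>x. x \<in> S \<Longrightarrow> g x = f x"
  shows "g differentiable_on S"
  unfolding differentiable_on_def
proof
  fix x assume x: "x \<in> S"
  then obtain f' where "(f has_derivative f') (at x within S)"
    using assms(1) by (auto simp: differentiable_on_def differentiable_def)
  then have "(g has_derivative f') (at x within S)"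
    by (rule has_derivative_transform[OF x, rotated]) (rule assms(2))
  then show "g differentiable (at x within S)"
    by (rule differentiableI)
qed

text \<open>The product rule turns one derivative of a product into a sum of products of one order less,
  so the closure properties of smooth maps are proved order by order.\<close>

primrec times_differentiable_on ::
  "nat \<Rightarrow> real set \<Rightarrow> (real \<Rightarrow> 'a::real_normed_vector) \<Rightarrow> bool" where
  "times_differentiable_on 0 I f \<longleftrightarrow> True"
| "times_differentiable_on (Suc k) I f \<longleftrightarrow>
     f differentiable_on I \<and> times_differentiable_on k I (deriv_on I f)"

lemma times_differentiable_on_iff_funpow:
  "times_differentiable_on k I f \<longleftrightarrow> (\<forall>j<k. (deriv_on I ^^ j) f differentiable_on I)"
proof (induction k arbitrary: f)
  case (Suc k)
  then show ?case
    by (auto simp: less_Suc_eq_0_disj funpow_swap1)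
qed simp

lemma smooth_map_on_iff_times_differentiable_on:
  "smooth_map_on I f \<longleftrightarrow> (\<forall>k. times_differentiable_on k I f)"
  unfolding smooth_map_on_def times_differentiable_on_iff_funpow by blast

lemma times_differentiable_on_SucD:
  "times_differentiable_on (Suc k) I f \<Longrightarrow> times_differentiable_on k I f"
  by (simp add: times_differentiable_on_iff_funpow)

lemma times_differentiable_on_SucI:
  assumes "nontrivial_interval I"
    and "\<And>t. t \<in> I \<Longrightarrow> (f has_vector_derivative f' t) (at t within I)"
    and "times_differentiable_on k I f'"
  shows "times_differentiable_on (Suc k) I f"
proof -
  \<comment> \<open>The given derivative agrees with \<open>deriv_on I f\<close> on \<open>I\<close> only, so differentiability to order
    \<open>k\<close> has to be insensitive to the values elsewhere.\<close>
  have cong: "times_differentiable_on k I h"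
    if "times_differentiable_on k I g" "\<And>t. t \<in> I \<Longrightarrow> g t = h t" for g h :: "real \<Rightarrow> 'a"
    using that
  proof (induction k arbitrary: g h)
    case (Suc k)
    have der: "(h has_vector_derivative deriv_on I g t) (at t within I)" if "t \<in> I" for t
      using has_vector_derivative_transform[OF that, of h g] has_vector_derivative_deriv_on[OF _ that]
        Suc.prems by auto
    then have "deriv_on I g t = deriv_on I h t" if "t \<in> I" for t
      using deriv_on_eqI[OF assms(1) that] that by metis
    moreover have "times_differentiable_on k I (deriv_on I g)"
      using Suc.prems by simp
    ultimately show ?case
      using Suc.IH[of "deriv_on I g" "deriv_on I h"] der differentiable_onI_vector[of I h]
      by auto
  qed simp
  have "f' t = deriv_on I f t" if "t \<in> I" for t
    using deriv_on_eqI[OF assms(1) that] assms(2) that by metis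
  then show ?thesis
    using cong[OF assms(3)] differentiable_onI_vector[OF assms(2)] by simp
qed

lemma times_differentiable_on_add:
  assumes "nontrivial_interval I" "times_differentiable_on k I f" "times_differentiable_on k I g"
  shows "times_differentiable_on k I (\<lambda>t. f t + g t)"
  using assms(2,3)
proof (induction k arbitrary: f g)
  case (Suc k)
  then have "times_differentiable_on k I (\<lambda>t. deriv_on I f t + deriv_on I g t)"
    by simp
  with Suc.prems show ?case
    by (intro times_differentiable_on_SucI[OF assms(1)])
      (auto intro!: has_vector_derivative_add has_vector_derivative_deriv_on)
qed simp

lemma times_differentiable_on_linear:
  assumes "bounded_linear L" "nontrivial_interval I" "times_differentiable_on k I f"
  shows "times_differentiable_on k I (\<lambda>t. L (f t))"
  using assms(3)
proof (induction k arbitrary: f)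
  case (Suc k)
  then have "times_differentiable_on k I (\<lambda>t. L (deriv_on I f t))"
    by simp
  with Suc.prems show ?case
    by (intro times_differentiable_on_SucI[OF assms(2)])
      (auto intro!: bounded_linear.has_vector_derivative[OF assms(1)]
        has_vector_derivative_deriv_on)
qed simp

lemma times_differentiable_on_bilinear:
  assumes "bounded_bilinear B" "nontrivial_interval I"
    and "times_differentiable_on k I f" "times_differentiable_on k I g"
  shows "times_differentiable_on k I (\<lambda>t. B (f t) (g t))"
  using assms(3,4)
proof (induction k arbitrary: f g)
  case (Suc k)
  then have "times_differentiable_on k I (\<lambda>t. B (f t) (deriv_on I g t) + B (deriv_on I f t) (g t))"
    using Suc.prems[THEN times_differentiable_on_SucD]
    by (intro times_differentiable_on_add[OF assms(2)] Suc.IH) auto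
  with Suc.prems show ?case
    by (intro times_differentiable_on_SucI[OF assms(2)])
      (auto intro!: bounded_bilinear.has_vector_derivative[OF assms(1)]
        has_vector_derivative_deriv_on)
qed simp

text \<open>Sine and cosine are each other's derivatives up to sign, so they are treated together.\<close>

lemma times_differentiable_on_sin_cos:
  fixes f :: "real \<Rightarrow> real"
  assumes "nontrivial_interval I" "times_differentiable_on k I f"
  shows "times_differentiable_on k I (\<lambda>t. sin (f t)) \<and> times_differentiable_on k I (\<lambda>t. cos (f t))"
  using assms(2)
proof (induction k)
  case (Suc k)
  then have IH: "times_differentiable_on k I (\<lambda>t. sin (f t))"
      "times_differentiable_on k I (\<lambda>t. cos (f t))"
    using times_differentiable_on_SucD by blast+
  have f': "times_differentiable_on k I (deriv_on I f)"
    using Suc.prems by simp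
  have der: "(f has_real_derivative deriv_on I f t) (at t within I)" if "t \<in> I" for t
    using has_vector_derivative_deriv_on[OF _ that, of f] Suc.prems
    by (simp add: has_real_derivative_iff_has_vector_derivative)
  note mult = times_differentiable_on_bilinear[OF bounded_bilinear_mult assms(1) _ f']
  have "times_differentiable_on (Suc k) I (\<lambda>t. sin (f t))"
  proof (rule times_differentiable_on_SucI[OF assms(1)])
    show "times_differentiable_on k I (\<lambda>t. cos (f t) * deriv_on I f t)"
      by (rule mult[OF IH(2)])
  qed (auto intro!: derivative_eq_intros der
      simp flip: has_real_derivative_iff_has_vector_derivative)
  moreover have "times_differentiable_on (Suc k) I (\<lambda>t. cos (f t))"
  proof (rule times_differentiable_on_SucI[OF assms(1)])
    show "times_differentiable_on k I (\<lambda>t. - (sin (f t) * deriv_on I f t))"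
      by (rule times_differentiable_on_linear[OF bounded_linear_minus[OF bounded_linear_ident]
            assms(1) mult[OF IH(1)]])
  qed (auto intro!: derivative_eq_intros der
      simp flip: has_real_derivative_iff_has_vector_derivative)
  ultimately show ?case ..
qed simp

lemma smooth_map_on_imp_differentiable_on: "smooth_map_on I f \<Longrightarrow> f differentiable_on I"
  unfolding smooth_map_on_def by (metis funpow_0)

lemma smooth_map_on_deriv_on: "smooth_map_on I f \<Longrightarrow> smooth_map_on I (deriv_on I f)"
  unfolding smooth_map_on_iff_times_differentiable_on by (metis times_differentiable_on.simps(2))

lemma smooth_map_on_antiderivative:
  assumes "nontrivial_interval I"
    and "\<And>t. t \<in> I \<Longrightarrow> (f has_vector_derivative f' t) (at t within I)"
    and "smooth_map_on I f'"
  shows "smooth_map_on I f"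
  unfolding smooth_map_on_iff_times_differentiable_on
proof
  fix k
  have "times_differentiable_on k I f'"
    using assms(3) by (simp add: smooth_map_on_iff_times_differentiable_on)
  then have "times_differentiable_on (Suc k) I f"
    by (rule times_differentiable_on_SucI[OF assms(1), rotated]) (rule assms(2))
  then show "times_differentiable_on k I f"
    by (rule times_differentiable_on_SucD)
qed

lemma smooth_map_on_add:
  "\<lbrakk>nontrivial_interval I; smooth_map_on I f; smooth_map_on I g\<rbrakk>
    \<Longrightarrow> smooth_map_on I (\<lambda>t. f t + g t)"
  by (simp add: smooth_map_on_iff_times_differentiable_on times_differentiable_on_add)

lemma smooth_map_on_linear:
  "\<lbrakk>bounded_linear L; nontrivial_interval I; smooth_map_on I f\<rbrakk>
    \<Longrightarrow> smooth_map_on I (\<lambda>t. L (f t))"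
  by (simp add: smooth_map_on_iff_times_differentiable_on times_differentiable_on_linear)

lemma smooth_map_on_bilinear:
  "\<lbrakk>bounded_bilinear B; nontrivial_interval I; smooth_map_on I f; smooth_map_on I g\<rbrakk>
    \<Longrightarrow> smooth_map_on I (\<lambda>t. B (f t) (g t))"
  by (simp add: smooth_map_on_iff_times_differentiable_on times_differentiable_on_bilinear)

lemma smooth_map_on_sin_cos:
  fixes f :: "real \<Rightarrow> real"
  assumes "nontrivial_interval I" "smooth_map_on I f"
  shows "smooth_map_on I (\<lambda>t. sin (f t))" "smooth_map_on I (\<lambda>t. cos (f t))"
  using assms times_differentiable_on_sin_cos
  unfolding smooth_map_on_iff_times_differentiable_on by blast+

lemma smooth_map_on_Pair_iff:
  fixes f :: "real \<Rightarrow> 'a::real_normed_vector" and g :: "real \<Rightarrow> 'b::real_normed_vector"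
  assumes "nontrivial_interval I"
  shows "smooth_map_on I (\<lambda>t. (f t, g t)) \<longleftrightarrow> smooth_map_on I f \<and> smooth_map_on I g"
proof
  assume fg: "smooth_map_on I (\<lambda>t. (f t, g t))"
  show "smooth_map_on I f \<and> smooth_map_on I g"
    using smooth_map_on_linear[OF bounded_linear_fst assms fg]
      smooth_map_on_linear[OF bounded_linear_snd assms fg] by simp
next
  assume fg: "smooth_map_on I f \<and> smooth_map_on I g"
  \<comment> \<open>A pair is the sum of its images under the two linear inclusions.\<close>
  have inl: "bounded_linear (\<lambda>x. (x, 0::'b))"
    by (rule bounded_linear_Pair[OF bounded_linear_ident bounded_linear_zero])
  have inr: "bounded_linear (\<lambda>x. (0::'a, x))"
    by (rule bounded_linear_Pair[OF bounded_linear_zero bounded_linear_ident])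
  have "smooth_map_on I (\<lambda>t. (f t, 0::'b) + (0::'a, g t))"
    using fg smooth_map_on_add[OF assms smooth_map_on_linear[OF inl assms]
        smooth_map_on_linear[OF inr assms]] by blast
  then show "smooth_map_on I (\<lambda>t. (f t, g t))"
    by simp
qed

section \<open>The angle function of a curve in the unit circle\<close>

text \<open>Near \<open>t\<close> the difference \<open>\<theta> s - \<theta> t\<close> lies in \<open>(-\<pi>/2, \<pi>/2)\<close>, where it is the arcsine of its sine,
  and the addition theorem writes that sine through \<open>sin \<theta>\<close> and \<open>cos \<theta>\<close>.\<close>

lemma continuous_angle_differentiable:
  fixes \<theta> :: "real \<Rightarrow> real"
  assumes "continuous_on I \<theta>"
    and "(\<lambda>t. sin (\<theta> t)) differentiable_on I" "(\<lambda>t. cos (\<theta> t)) differentiable_on I"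
  shows "\<theta> differentiable_on I"
  unfolding differentiable_on_def
proof
  fix t assume t: "t \<in> I"
  obtain a' where a': "((\<lambda>s. sin (\<theta> s)) has_real_derivative a') (at t within I)"
    using assms(2) t unfolding differentiable_on_def real_differentiable_def by blast
  obtain b' where b': "((\<lambda>s. cos (\<theta> s)) has_real_derivative b') (at t within I)"
    using assms(3) t unfolding differentiable_on_def real_differentiable_def by blast
  define S where "S s = sin (\<theta> s) * cos (\<theta> t) - cos (\<theta> s) * sin (\<theta> t)" for s
  have "(S has_real_derivative a' * cos (\<theta> t) - b' * sin (\<theta> t)) (at t within I)"
    unfolding S_def by (intro DERIV_diff DERIV_cmult_right a' b')
  moreover have "(arcsin has_real_derivative 1) (at (S t))"
    using DERIV_arcsin[of 0] by (simp add: S_def)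
  ultimately have "((\<lambda>s. arcsin (S s)) has_real_derivative
      1 * (a' * cos (\<theta> t) - b' * sin (\<theta> t))) (at t within I)"
    by (rule DERIV_chain2[rotated])
  then have der: "((\<lambda>s. \<theta> t + arcsin (S s)) has_real_derivative
      1 * (a' * cos (\<theta> t) - b' * sin (\<theta> t))) (at t within I)"
    using DERIV_add[OF DERIV_const[of "\<theta> t"]] by fastforce
  obtain d where d: "d > 0" "\<And>s. s \<in> I \<Longrightarrow> dist s t < d \<Longrightarrow> dist (\<theta> s) (\<theta> t) < pi / 2"
    using assms(1) t pi_half_gt_zero unfolding continuous_on_iff by metis
  have "\<theta> t + arcsin (S s) = \<theta> s" if "s \<in> I" "dist s t < d" for s
  proof -
    have "S s = sin (\<theta> s - \<theta> t)"
      by (simp add: S_def sin_diff)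
    moreover have "\<bar>\<theta> s - \<theta> t\<bar> < pi / 2"
      using d(2)[OF that] by (simp add: dist_real_def)
    ultimately show ?thesis
      by (simp add: arcsin_sin abs_if split: if_splits)
  qed
  then have "(\<theta> has_real_derivative 1 * (a' * cos (\<theta> t) - b' * sin (\<theta> t))) (at t within I)"
    using has_field_derivative_transform_within[OF der d(1) t] by blast
  then show "\<theta> differentiable (at t within I)"
    using real_differentiable_def by blast
qed

text \<open>Differentiating \<open>sin \<theta> = a\<close> and \<open>cos \<theta> = b\<close> shows that the derivative of a differentiable angle is
  \<open>b\<close> times the derivative of \<open>a\<close> minus \<open>a\<close> times the derivative of \<open>b\<close>. This is smooth and does not
  involve \<open>\<theta>\<close>, so a single derivative of \<open>\<theta>\<close> already makes \<open>\<theta>\<close> smooth.\<close>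

lemma smooth_angle_function:
  fixes a b :: "real \<Rightarrow> real"
  assumes I: "nontrivial_interval I"
    and smooth: "smooth_map_on I a" "smooth_map_on I b"
    and circle: "\<And>t. t \<in> I \<Longrightarrow> (a t)\<^sup>2 + (b t)\<^sup>2 = 1"
  shows "\<exists>\<theta>. smooth_map_on I \<theta> \<and> (\<forall>t\<in>I. a t = sin (\<theta> t) \<and> b t = cos (\<theta> t))"
proof -
  have diff: "a differentiable_on I" "b differentiable_on I"
    using smooth smooth_map_on_imp_differentiable_on by blast+
  have "continuous_on I (\<lambda>t. Complex (b t) (a t))"
    unfolding Complex_eq by (intro continuous_intros differentiable_imp_continuous_on diff)
  moreover have "contractible I"
    using I by (simp add: nontrivial_interval_def is_interval_convex_1 convex_imp_contractible)
  moreover have "Complex (b t) (a t) \<noteq> 0" if "t \<in> I" for t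
    using circle[OF that] by (auto simp: complex_eq_iff)
  ultimately obtain h where h: "continuous_on I h"
      "\<And>t. t \<in> I \<Longrightarrow> Complex (b t) (a t) = exp (h t)"
    using continuous_logarithm_on_contractible[of I "\<lambda>t. Complex (b t) (a t)"] by metis
  define \<theta> where "\<theta> t = Im (h t)" for t
  have ab: "a t = sin (\<theta> t)" "b t = cos (\<theta> t)" if t: "t \<in> I" for t
  proof -
    have "norm (Complex (b t) (a t)) = 1"
      using circle[OF t] by (simp add: cmod_def add.commute)
    then have "exp (Re (h t)) = 1"
      using h(2)[OF t] by (metis norm_exp_eq_Re)
    then show "a t = sin (\<theta> t)" "b t = cos (\<theta> t)"
      using h(2)[OF t] by (auto simp: complex_eq_iff Re_exp Im_exp \<theta>_def)
  qed
  have "\<theta> differentiable_on I"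
  proof (rule continuous_angle_differentiable)
    show "continuous_on I \<theta>"
      unfolding \<theta>_def using h(1) by (intro continuous_intros)
    show "(\<lambda>t. sin (\<theta> t)) differentiable_on I" "(\<lambda>t. cos (\<theta> t)) differentiable_on I"
      using diff ab differentiable_on_transform by metis+
  qed
  then have \<theta>': "(\<theta> has_real_derivative deriv_on I \<theta> t) (at t within I)" if "t \<in> I" for t
    using has_vector_derivative_deriv_on that
    by (simp add: has_real_derivative_iff_has_vector_derivative)
  have "deriv_on I \<theta> t = b t * deriv_on I a t + - (a t * deriv_on I b t)" if t: "t \<in> I" for t
  proof -
    have "((\<lambda>t. sin (\<theta> t)) has_real_derivative cos (\<theta> t) * deriv_on I \<theta> t) (at t within I)"
      "((\<lambda>t. cos (\<theta> t)) has_real_derivative - sin (\<theta> t) * deriv_on I \<theta> t) (at t within I)"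
      by (auto intro!: derivative_eq_intros \<theta>'[OF t])
    then have "(a has_vector_derivative cos (\<theta> t) * deriv_on I \<theta> t) (at t within I)"
      "(b has_vector_derivative - sin (\<theta> t) * deriv_on I \<theta> t) (at t within I)"
      unfolding has_real_derivative_iff_has_vector_derivative
      by (auto intro: has_vector_derivative_transform[OF t] simp: ab)
    then have "deriv_on I a t = cos (\<theta> t) * deriv_on I \<theta> t"
      "deriv_on I b t = - sin (\<theta> t) * deriv_on I \<theta> t"
      using deriv_on_eqI[OF I t] by auto
    then have "b t * deriv_on I a t + - (a t * deriv_on I b t)
        = ((sin (\<theta> t))\<^sup>2 + (cos (\<theta> t))\<^sup>2) * deriv_on I \<theta> t"
      by (simp add: ab[OF t] algebra_simps power2_eq_square
          del: sin_cos_squared_add sin_cos_squared_add2 sin_cos_squared_add3)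
    then show ?thesis
      by simp
  qed
  then have "(\<theta> has_vector_derivative b t * deriv_on I a t + - (a t * deriv_on I b t)) (at t within I)"
    if "t \<in> I" for t
    using \<theta>'[OF that] that by (simp add: has_real_derivative_iff_has_vector_derivative)
  moreover have "smooth_map_on I (\<lambda>t. b t * deriv_on I a t + - (a t * deriv_on I b t))"
    using smooth smooth_map_on_deriv_on
    by (intro smooth_map_on_add[OF I] smooth_map_on_bilinear[OF bounded_bilinear_mult I]
        smooth_map_on_linear[OF bounded_linear_minus[OF bounded_linear_ident] I]) auto
  ultimately have "smooth_map_on I \<theta>"
    by (rule smooth_map_on_antiderivative[OF I])
  then show ?thesis
    using ab by blast
qed

section \<open>Moving frames\<close>

lemma Delta_iff: "(a, b) \<in> Delta \<longleftrightarrow> a \<bullet> a = 1 \<and> b \<bullet> b = 1 \<and> a \<bullet> b = 0"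
  by (auto simp: Delta_def norm_eq_1)

lemma cross3_dot_self_Delta:
  assumes "(a, b) \<in> Delta"
  shows "cross3 a b \<bullet> cross3 a b = 1"
  using assms dot_cross[of a b a b] by (simp add: Delta_iff inner_commute)

text \<open>The difference of both sides is orthogonal to \<open>a\<close> and \<open>b\<close>, so by the Grassmann identity its
  cross product with \<open>a \<times> b\<close> vanishes. It is orthogonal to \<open>a \<times> b\<close> as well, so it is zero.\<close>

lemma Delta_expansion:
  assumes "(a, b) \<in> Delta"
  shows "x = (x \<bullet> a) *\<^sub>R a + (x \<bullet> b) *\<^sub>R b + (x \<bullet> cross3 a b) *\<^sub>R cross3 a b"
proof -
  let ?c = "cross3 a b"
  define y where "y = x - ((x \<bullet> a) *\<^sub>R a + (x \<bullet> b) *\<^sub>R b + (x \<bullet> ?c) *\<^sub>R ?c)"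
  have ab: "a \<bullet> a = 1" "b \<bullet> b = 1" "a \<bullet> b = 0" "b \<bullet> a = 0"
    using assms by (auto simp: Delta_iff inner_commute)
  have c: "?c \<bullet> ?c = 1"
    by (rule cross3_dot_self_Delta[OF assms])
  have orth: "y \<bullet> a = 0" "y \<bullet> b = 0" "y \<bullet> ?c = 0"
    by (simp_all add: y_def inner_diff_left inner_add_left ab c dot_cross_self)
  moreover from orth have "cross3 y ?c = 0"
    by (simp add: Lagrange)
  moreover have "?c \<noteq> 0"
    using c by auto
  ultimately have "y = 0"
    using norm_and_cross_eq_0[of y ?c] by blast
  then show ?thesis
    by (simp add: y_def)
qed

lemma framed_curve_smooth:
  assumes "nontrivial_interval I" "framed_curve I \<gamma> \<nu>1 \<nu>2"
  shows "smooth_map_on I \<gamma>" "smooth_map_on I \<nu>1" "smooth_map_on I \<nu>2"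
  using assms unfolding framed_curve_def smooth_map_on_Pair_iff[OF assms(1)] by blast+

lemma inner_deriv_on_of_constant_inner:
  fixes f g :: "real \<Rightarrow> 'a::real_inner"
  assumes "nontrivial_interval I" "t \<in> I" "f differentiable_on I" "g differentiable_on I"
    and "\<And>s. s \<in> I \<Longrightarrow> f s \<bullet> g s = c"
  shows "deriv_on I f t \<bullet> g t + f t \<bullet> deriv_on I g t = 0"
proof -
  have "((\<lambda>s. f s \<bullet> g s) has_vector_derivative f t \<bullet> deriv_on I g t + deriv_on I f t \<bullet> g t)
      (at t within I)"
    by (intro bounded_bilinear.has_vector_derivative[OF bounded_bilinear_inner]
        has_vector_derivative_deriv_on assms(2-4))
  moreover have "((\<lambda>s. f s \<bullet> g s) has_vector_derivative 0) (at t within I)"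
    by (rule has_vector_derivative_transform[OF assms(2) _ has_vector_derivative_const[of c]])
      (simp add: assms(5))
  ultimately show ?thesis
    using deriv_on_eqI[OF assms(1,2)] by (metis add.commute)
qed

text \<open>The inner products of \<open>\<nu>1\<close> and \<open>\<nu>2\<close> are constant, so the matrix of the derivatives of \<open>\<nu>1\<close> and \<open>\<nu>2\<close>
  in these two vectors is skew-symmetric with \<open>l\<close> as its only entry up to sign; the remaining
  coordinates are those in the definition of the curvature.\<close>

lemma deriv_on_frame:
  assumes I: "nontrivial_interval I" and fc: "framed_curve I \<gamma> \<nu>1 \<nu>2"
    and curv: "curvature I \<gamma> \<nu>1 \<nu>2 t = (l, m, n, \<alpha>)" and t: "t \<in> I"
  shows "deriv_on I \<gamma> t = \<alpha> *\<^sub>R mu_of \<nu>1 \<nu>2 t"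
    "deriv_on I \<nu>1 t = l *\<^sub>R \<nu>2 t + m *\<^sub>R mu_of \<nu>1 \<nu>2 t"
    "deriv_on I \<nu>2 t = - l *\<^sub>R \<nu>1 t + n *\<^sub>R mu_of \<nu>1 \<nu>2 t"
proof -
  have Delta: "(\<nu>1 s, \<nu>2 s) \<in> Delta" if "s \<in> I" for s
    using fc that by (simp add: framed_curve_def)
  note diff = framed_curve_smooth(2,3)[OF I fc, THEN smooth_map_on_imp_differentiable_on]
  have "deriv_on I \<nu>1 t \<bullet> \<nu>1 t + \<nu>1 t \<bullet> deriv_on I \<nu>1 t = 0"
    "deriv_on I \<nu>2 t \<bullet> \<nu>2 t + \<nu>2 t \<bullet> deriv_on I \<nu>2 t = 0"
    "deriv_on I \<nu>1 t \<bullet> \<nu>2 t + \<nu>1 t \<bullet> deriv_on I \<nu>2 t = 0"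
    using Delta by (auto intro!: inner_deriv_on_of_constant_inner[OF I t] diff simp: Delta_iff)
  then have "deriv_on I \<nu>1 t \<bullet> \<nu>1 t = 0" "deriv_on I \<nu>2 t \<bullet> \<nu>2 t = 0"
    "deriv_on I \<nu>2 t \<bullet> \<nu>1 t = - (deriv_on I \<nu>1 t \<bullet> \<nu>2 t)"
    by (simp_all add: inner_commute)
  moreover have "deriv_on I \<gamma> t \<bullet> \<nu>1 t = 0" "deriv_on I \<gamma> t \<bullet> \<nu>2 t = 0"
    using fc t by (auto simp: framed_curve_def)
  moreover have "l = deriv_on I \<nu>1 t \<bullet> \<nu>2 t" "m = deriv_on I \<nu>1 t \<bullet> mu_of \<nu>1 \<nu>2 t"
    "n = deriv_on I \<nu>2 t \<bullet> mu_of \<nu>1 \<nu>2 t" "\<alpha> = deriv_on I \<gamma> t \<bullet> mu_of \<nu>1 \<nu>2 t"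
    using curv by (auto simp: curvature_def)
  ultimately show "deriv_on I \<gamma> t = \<alpha> *\<^sub>R mu_of \<nu>1 \<nu>2 t"
    "deriv_on I \<nu>1 t = l *\<^sub>R \<nu>2 t + m *\<^sub>R mu_of \<nu>1 \<nu>2 t"
    "deriv_on I \<nu>2 t = - l *\<^sub>R \<nu>1 t + n *\<^sub>R mu_of \<nu>1 \<nu>2 t"
    by - (rule trans[OF Delta_expansion[OF Delta[OF t]]], simp add: mu_of_def)+
qed

lemma deriv_on_parallel_curve:
  assumes I: "nontrivial_interval I" and fc: "framed_curve I \<gamma> \<nu>1 \<nu>2"
    and curv: "curvature I \<gamma> \<nu>1 \<nu>2 t = (l, m, n, \<alpha>)" and t: "t \<in> I"
    and diff: "lam differentiable_on I" "\<eta> differentiable_on I"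
    and \<gamma>': "\<And>s. s \<in> I \<Longrightarrow> \<gamma>' s = \<gamma> s + lam s *\<^sub>R \<nu>1 s + \<eta> s *\<^sub>R \<nu>2 s"
  shows "deriv_on I \<gamma>' t = (deriv_on I lam t - \<eta> t * l) *\<^sub>R \<nu>1 t
    + (lam t * l + deriv_on I \<eta> t) *\<^sub>R \<nu>2 t
    + (\<alpha> + lam t * m + \<eta> t * n) *\<^sub>R mu_of \<nu>1 \<nu>2 t"
proof -
  note der = framed_curve_smooth[OF I fc, THEN smooth_map_on_imp_differentiable_on,
      THEN has_vector_derivative_deriv_on[OF _ t]] diff[THEN has_vector_derivative_deriv_on[OF _ t]]
  note scaleR = bounded_bilinear.has_vector_derivative[OF bounded_bilinear_scaleR]
  have "(\<gamma>' has_vector_derivative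
      deriv_on I \<gamma> t + (lam t *\<^sub>R deriv_on I \<nu>1 t + deriv_on I lam t *\<^sub>R \<nu>1 t)
      + (\<eta> t *\<^sub>R deriv_on I \<nu>2 t + deriv_on I \<eta> t *\<^sub>R \<nu>2 t)) (at t within I)"
    by (rule has_vector_derivative_transform[OF t _
          has_vector_derivative_add[OF has_vector_derivative_add[OF der(1) scaleR[OF der(4,2)]]
            scaleR[OF der(5,3)]]])
      (rule \<gamma>')
  then have "deriv_on I \<gamma>' t =
      deriv_on I \<gamma> t + (lam t *\<^sub>R deriv_on I \<nu>1 t + deriv_on I lam t *\<^sub>R \<nu>1 t)
      + (\<eta> t *\<^sub>R deriv_on I \<nu>2 t + deriv_on I \<eta> t *\<^sub>R \<nu>2 t)"
    by (rule deriv_on_eqI[OF I t])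
  then show ?thesis
    unfolding deriv_on_frame[OF I fc curv t] by (simp add: algebra_simps)
qed

section \<open>Bertrand mates\<close>

theorem theorem4p3:
  fixes I :: "real set"
    and \<gamma> \<nu>1 \<nu>2 :: "real \<Rightarrow> real^3"
    and l m n \<alpha> :: "real \<Rightarrow> real"
  assumes "nontrivial_interval I"
    and "framed_curve I \<gamma> \<nu>1 \<nu>2"
    and "\<And>t. t \<in> I \<Longrightarrow> curvature I \<gamma> \<nu>1 \<nu>2 t = (l t, m t, n t, \<alpha> t)"
  shows "Bertrand_framed_curve I Nu1 Nu2 Nu2 \<gamma> \<nu>1 \<nu>2 \<longleftrightarrow>
    (\<exists>lam \<eta> \<theta> :: real \<Rightarrow> real.
       smooth_map_on I (\<lambda>t. (lam t, \<eta> t)) \<and>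
       not_identically_zero I (\<lambda>t. (lam t, \<eta> t)) \<and>
       smooth_map_on I \<theta> \<and>
       (\<forall>t\<in>I. \<alpha> t + lam t * m t + \<eta> t * n t = 0 \<and>
              (deriv_on I lam t - \<eta> t * l t) * sin (\<theta> t) +
              (lam t * l t + deriv_on I \<eta> t) * cos (\<theta> t) = 0))"
    (is "_ \<longleftrightarrow> (\<exists>lam \<eta> \<theta>. ?smooth lam \<eta> \<and> ?nonzero lam \<eta> \<and> smooth_map_on I \<theta> \<and> ?eqs lam \<eta> \<theta>)")
proof -
  note I = assms(1) and fc = assms(2) and curv = assms(3)
  let ?\<mu> = "mu_of \<nu>1 \<nu>2"
  note smooth = framed_curve_smooth[OF I fc]
  have Delta: "(\<nu>1 t, \<nu>2 t) \<in> Delta" if "t \<in> I" for t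
    using fc that by (simp add: framed_curve_def)
  have ortho: "\<nu>1 t \<bullet> \<nu>1 t = 1" "\<nu>2 t \<bullet> \<nu>2 t = 1" "?\<mu> t \<bullet> ?\<mu> t = 1"
    "\<nu>1 t \<bullet> \<nu>2 t = 0" "\<nu>2 t \<bullet> \<nu>1 t = 0" "\<nu>1 t \<bullet> ?\<mu> t = 0" "?\<mu> t \<bullet> \<nu>1 t = 0"
    "\<nu>2 t \<bullet> ?\<mu> t = 0" "?\<mu> t \<bullet> \<nu>2 t = 0" if "t \<in> I" for t
    using Delta[OF that] cross3_dot_self_Delta[OF Delta[OF that]]
    by (auto simp: Delta_iff mu_of_def dot_cross_self inner_commute)
  \<comment> \<open>For a curve at offsets \<open>lam\<close>, \<open>\<eta>\<close>, the two equations are the orthogonality of its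
    velocity to \<open>?\<mu>\<close> and to the rotated vector.\<close>
  have velocity: "deriv_on I \<gamma>' t \<bullet> ?\<mu> t = \<alpha> t + lam t * m t + \<eta> t * n t"
    "deriv_on I \<gamma>' t \<bullet> (sin \<phi> *\<^sub>R \<nu>1 t + cos \<phi> *\<^sub>R \<nu>2 t) =
      (deriv_on I lam t - \<eta> t * l t) * sin \<phi> + (lam t * l t + deriv_on I \<eta> t) * cos \<phi>"
    if "?smooth lam \<eta>" "\<And>s. s \<in> I \<Longrightarrow> \<gamma>' s = \<gamma> s + lam s *\<^sub>R \<nu>1 s + \<eta> s *\<^sub>R \<nu>2 s"
      and t: "t \<in> I" for lam \<eta> \<gamma>' t \<phi>
  proof -
    have "lam differentiable_on I" "\<eta> differentiable_on I"
      using that(1) smooth_map_on_imp_differentiable_on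
      unfolding smooth_map_on_Pair_iff[OF I] by blast+
    note vel = deriv_on_parallel_curve[OF I fc curv[OF t] t this that(2)]
    show "deriv_on I \<gamma>' t \<bullet> ?\<mu> t = \<alpha> t + lam t * m t + \<eta> t * n t"
      "deriv_on I \<gamma>' t \<bullet> (sin \<phi> *\<^sub>R \<nu>1 t + cos \<phi> *\<^sub>R \<nu>2 t) =
      (deriv_on I lam t - \<eta> t * l t) * sin \<phi> + (lam t * l t + deriv_on I \<eta> t) * cos \<phi>"
      by (simp_all add: vel inner_add_left inner_add_right ortho[OF t])
  qed
  show ?thesis
  proof
    assume "Bertrand_framed_curve I Nu1 Nu2 Nu2 \<gamma> \<nu>1 \<nu>2"
    then obtain \<gamma>' \<nu>1' \<nu>2' where fc': "framed_curve I \<gamma>' \<nu>1' \<nu>2'"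
      and "mates I Nu1 Nu2 Nu2 \<gamma> \<nu>1 \<nu>2 \<gamma>' \<nu>1' \<nu>2'"
      unfolding Bertrand_framed_curve_def by blast
    then obtain lam \<eta> where offset: "?smooth lam \<eta>" "?nonzero lam \<eta>"
      and "\<forall>t\<in>I. \<gamma>' t = \<gamma> t + lam t *\<^sub>R \<nu>1 t + \<eta> t *\<^sub>R \<nu>2 t \<and>
        cross3 (\<nu>1 t) (\<nu>2 t) = \<nu>2' t"
      unfolding mates_def frame_vec.simps by blast
    then have \<gamma>': "\<And>t. t \<in> I \<Longrightarrow> \<gamma>' t = \<gamma> t + lam t *\<^sub>R \<nu>1 t + \<eta> t *\<^sub>R \<nu>2 t"
      and \<nu>2': "\<And>t. t \<in> I \<Longrightarrow> \<nu>2' t = ?\<mu> t"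
      by (simp_all add: mu_of_def)
    define a b where "a t = \<nu>1' t \<bullet> \<nu>1 t" and "b t = \<nu>1' t \<bullet> \<nu>2 t" for t
    have Delta': "(\<nu>1' t, ?\<mu> t) \<in> Delta" if "t \<in> I" for t
      using fc' that \<nu>2' by (auto simp: framed_curve_def)
    have \<nu>1': "\<nu>1' t = a t *\<^sub>R \<nu>1 t + b t *\<^sub>R \<nu>2 t" if "t \<in> I" for t
      using Delta'[OF that]
      by - (rule trans[OF Delta_expansion[OF Delta[OF that]]],
        simp add: a_def b_def Delta_iff mu_of_def)
    have circle: "(a t)\<^sup>2 + (b t)\<^sup>2 = 1" if "t \<in> I" for t
    proof -
      have "(a t)\<^sup>2 + (b t)\<^sup>2 = \<nu>1' t \<bullet> \<nu>1' t"
        unfolding \<nu>1'[OF that]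
        by (simp add: inner_add_left inner_add_right ortho[OF that] power2_eq_square)
      then show ?thesis
        using Delta'[OF that] by (simp add: Delta_iff)
    qed
    have "smooth_map_on I a" "smooth_map_on I b"
      unfolding a_def b_def
      by (intro smooth_map_on_bilinear[OF bounded_bilinear_inner I] smooth
          framed_curve_smooth(2)[OF I fc'])+
    then obtain \<theta> where \<theta>: "smooth_map_on I \<theta>" "\<And>t. t \<in> I \<Longrightarrow> a t = sin (\<theta> t)"
        "\<And>t. t \<in> I \<Longrightarrow> b t = cos (\<theta> t)"
      using smooth_angle_function[OF I, of a b] circle by blast
    have "?eqs lam \<eta> \<theta>"
    proof
      fix t assume t: "t \<in> I"
      have "deriv_on I \<gamma>' t \<bullet> ?\<mu> t = 0"
        "deriv_on I \<gamma>' t \<bullet> (sin (\<theta> t) *\<^sub>R \<nu>1 t + cos (\<theta> t) *\<^sub>R \<nu>2 t) = 0"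
        using fc' t \<nu>1'[OF t] \<nu>2'[OF t] \<theta>(2,3)[OF t] by (auto simp: framed_curve_def)
      then show "\<alpha> t + lam t * m t + \<eta> t * n t = 0 \<and>
          (deriv_on I lam t - \<eta> t * l t) * sin (\<theta> t) + (lam t * l t + deriv_on I \<eta> t) * cos (\<theta> t) = 0"
        using velocity[OF offset(1) \<gamma>' t] by simp
    qed
    with offset \<theta>(1)
    show "\<exists>lam \<eta> \<theta>. ?smooth lam \<eta> \<and> ?nonzero lam \<eta> \<and> smooth_map_on I \<theta> \<and> ?eqs lam \<eta> \<theta>"
      by blast
  next
    assume "\<exists>lam \<eta> \<theta>. ?smooth lam \<eta> \<and> ?nonzero lam \<eta> \<and> smooth_map_on I \<theta> \<and> ?eqs lam \<eta> \<theta>"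
    then obtain lam \<eta> \<theta> where offset: "?smooth lam \<eta>" "?nonzero lam \<eta>"
      and \<theta>: "smooth_map_on I \<theta>" and eqs: "?eqs lam \<eta> \<theta>"
      by blast
    define \<gamma>' where "\<gamma>' t = \<gamma> t + lam t *\<^sub>R \<nu>1 t + \<eta> t *\<^sub>R \<nu>2 t" for t
    define \<nu>1' where "\<nu>1' t = sin (\<theta> t) *\<^sub>R \<nu>1 t + cos (\<theta> t) *\<^sub>R \<nu>2 t" for t
    have "smooth_map_on I lam" "smooth_map_on I \<eta>"
      using offset(1) unfolding smooth_map_on_Pair_iff[OF I] by blast+
    then have "smooth_map_on I \<gamma>'"
      unfolding \<gamma>'_def
      by (intro smooth_map_on_add[OF I] smooth smooth_map_on_bilinear[OF bounded_bilinear_scaleR I])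
    moreover have "smooth_map_on I \<nu>1'"
      unfolding \<nu>1'_def
      by (intro smooth_map_on_add[OF I] smooth smooth_map_on_sin_cos[OF I \<theta>]
          smooth_map_on_bilinear[OF bounded_bilinear_scaleR I])
    moreover have "smooth_map_on I ?\<mu>"
      unfolding mu_of_def
      by (intro smooth smooth_map_on_bilinear[OF bilinear_cross[unfolded bilinear_conv_bounded_bilinear] I])
    moreover have "(\<nu>1' t, ?\<mu> t) \<in> Delta" if "t \<in> I" for t
      by (simp add: \<nu>1'_def Delta_iff inner_add_left inner_add_right ortho[OF that]
          flip: power2_eq_square)
    moreover have "deriv_on I \<gamma>' t \<bullet> \<nu>1' t = 0" "deriv_on I \<gamma>' t \<bullet> ?\<mu> t = 0" if t: "t \<in> I" for t
      using velocity[OF offset(1) \<gamma>'_def t] eqs t by (simp_all add: \<nu>1'_def)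
    ultimately have "framed_curve I \<gamma>' \<nu>1' ?\<mu>"
      by (simp add: framed_curve_def smooth_map_on_Pair_iff[OF I])
    moreover from this have "mates I Nu1 Nu2 Nu2 \<gamma> \<nu>1 \<nu>2 \<gamma>' \<nu>1' ?\<mu>"
      unfolding mates_def frame_vec.simps using fc offset
      by (intro conjI exI[of _ lam] exI[of _ \<eta>]) (auto simp: \<gamma>'_def mu_of_def)
    ultimately show "Bertrand_framed_curve I Nu1 Nu2 Nu2 \<gamma> \<nu>1 \<nu>2"
      unfolding Bertrand_framed_curve_def by blast
  qed
qed

end
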